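(* Let $H$ be a real Hilbert space, $F:H\to H$, and $z_0\in H$. Assume: 1. the equation $F(z)=0$ has a unique solution $y\in H$; 2. $F$ is w-continuous and twice Fréchet differentiable, $(F'(h)\xi,\xi)\ge 0$ for all $h,\xi\in H$, and there are positive constants $N_1,N_2$ with $\|F'(x)\|\le N_1$ and $\|F''(x)\|\le N_2$ for all $x\in H$; 3. $\varepsilon:[0,\infty)\to(0,\infty)$ is continuously differentiable and tends monotonically to $0$ as $t\to+\infty$, and $$C_\varepsilon:=\max_{t\in[0,\infty)}\frac{\varepsilon(0)|\dot\varepsilon(t)|}{\varepsilon^2(t)}<1;$$ 4. $$\varepsilon(0)>\frac{N_2\|z_0-y\|}{1-C_\varepsilon}\max\left\{1,\frac{2C_\varepsilon}{1-C_\varepsilon}\right\};$$ 5. $\Phi(h,t):=-[F'(h)+\varepsilon(t)I]^{-1}[F(h)+\varepsilon(t)(h-z_0)]$ for $h\in H$, $t\ge0$. For each $t\ge0$ let $x(t)\in H$ be the unique solution of $F(x)+\varepsilon(t)(x-z_0)=0$. Then the Cauchy problem $$\dot z(t)=\Phi(z(t),t),\qquad z(0)=z_0,$$ has a unique solution $z(t)$ for $t\in[0,+\infty)$, and $$\|z(t)-x(t)\|\le\frac{1-C_\varepsilon}{N_2}\,\varepsilon(t)\ \ (t\ge 0),\qquad \lim_{t\to+\infty}\|z(t)-y\|=0.$$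
   Context: $F$ is called w-continuous if weak convergence $x\rightharpoonup\xi$ in $H$ implies weak convergence $F(x)\rightharpoonup F(\xi)$. $I$ is the identity operator, $F'$ and $F''$ are the first and second Fréchet derivatives, and a dot denotes the derivative with respect to $t$. Under the positivity assumption on $F'$, the operator $F'(h)+\varepsilon I$ is boundedly invertible for every $\varepsilon>0$, and the equation $F(x)+\varepsilon(x-z_0)=0$ has exactly one solution for every $\varepsilon>0$. *)

theory Defs
  imports "HOL-Analysis.Analysis"
begin

text \<open>Weak convergence of sequences in a Hilbert space, with the functionals written as inner products.\<close>

definition weakly_converges :: "(nat \<Rightarrow> 'a::real_inner) \<Rightarrow> 'a \<Rightarrow> bool" where
  "weakly_converges u \<xi> \<longleftrightarrow> (\<forall>v. (\<lambda>n. inner (u n) v) \<longlonglongrightarrow> inner \<xi> v)"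

definition w_continuous :: "('a::real_inner \<Rightarrow> 'a) \<Rightarrow> bool" where
  "w_continuous F \<longleftrightarrow>
     (\<forall>u \<xi>. weakly_converges u \<xi> \<longrightarrow> weakly_converges (\<lambda>n. F (u n)) (F \<xi>))"

text \<open>The description below denotes a solution only when the equation is uniquely solvable,
  which is the case for monotone \<open>F\<close> with bounded derivative and \<open>e > 0\<close>.\<close>

definition regularized_solution :: "('a::real_inner \<Rightarrow> 'a) \<Rightarrow> 'a \<Rightarrow> real \<Rightarrow> 'a" where
  "regularized_solution F z0 e = (THE \<xi>. F \<xi> + e *\<^sub>R (\<xi> - z0) = 0)"

text \<open>In the following, \<open>F'\<close> is the Frechet derivative of \<open>F\<close>. The value \<open>inv A\<close> is the
  genuine inverse only if \<open>A\<close> is bijective, as it is when \<open>F' h\<close> is positive and \<open>\<epsilon> t > 0\<close>.\<close>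

definition newton_field ::
  "('a::real_inner \<Rightarrow> 'a) \<Rightarrow> ('a \<Rightarrow> 'a \<Rightarrow>\<^sub>L 'a) \<Rightarrow> (real \<Rightarrow> real) \<Rightarrow> 'a \<Rightarrow> 'a \<Rightarrow> real \<Rightarrow> 'a" where
  "newton_field F F' \<epsilon> z0 h t =
     - inv (blinfun_apply (F' h + \<epsilon> t *\<^sub>R id_blinfun)) (F h + \<epsilon> t *\<^sub>R (h - z0))"

definition solves_cauchy ::
  "('a::real_normed_vector \<Rightarrow> real \<Rightarrow> 'a) \<Rightarrow> 'a \<Rightarrow> (real \<Rightarrow> 'a) \<Rightarrow> bool" where
  "solves_cauchy \<Phi> z0 z \<longleftrightarrow>
     z 0 = z0 \<and> (\<forall>t\<ge>0. (z has_vector_derivative \<Phi> (z t) t) (at t within {0..}))"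

end

theory Submission
  imports Defs
begin

text \<open>
  Strong monotonicity makes \<open>F + e (I - z0)\<close> and its derivative bijective for \<open>e > 0\<close> by the
  contraction principle. In terms of the residual \<open>v = F z + \<epsilon> (z - z0)\<close> the Newton flow becomes
  \<open>v' = - v + \<epsilon>' (z - z0)\<close>, where \<open>z\<close> depends on \<open>v\<close> with Lipschitz constant \<open>1 / \<epsilon>\<close>; this equation is
  globally Lipschitz, which yields existence and uniqueness on the half-line. The error
  \<open>|z - x|\<close> cannot cross the barrier \<open>(1 - C) / N2 * \<epsilon>\<close>, because at a first contact its derivative
  would be smaller than that of the barrier. Finally the regularized solutions \<open>x\<close> converge strongly
  to \<open>y\<close> by the monotonicity of their distance to \<open>z0\<close>.
\<close>

section \<open>A copy of the type in the class \<open>banach\<close>\<close>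

text \<open>The sort \<open>{real_normed_vector, complete_space}\<close> is not below the class \<open>banach\<close>, which the
  vector-valued integral requires. A copy of the type is an instance of that class.\<close>

typedef 'a banach_copy = "UNIV :: 'a set"
  morphisms of_copy to_copy ..

setup_lifting type_definition_banach_copy

instantiation banach_copy :: (real_normed_vector) real_normed_vector
begin

lift_definition zero_banach_copy :: "'a banach_copy" is 0 .
lift_definition plus_banach_copy :: "'a banach_copy \<Rightarrow> 'a banach_copy \<Rightarrow> 'a banach_copy" is "(+)" .
lift_definition minus_banach_copy :: "'a banach_copy \<Rightarrow> 'a banach_copy \<Rightarrow> 'a banach_copy" is "(-)" .
lift_definition uminus_banach_copy :: "'a banach_copy \<Rightarrow> 'a banach_copy" is uminus .
lift_definition scaleR_banach_copy :: "real \<Rightarrow> 'a banach_copy \<Rightarrow> 'a banach_copy" is scaleR .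
lift_definition norm_banach_copy :: "'a banach_copy \<Rightarrow> real" is norm .
lift_definition sgn_banach_copy :: "'a banach_copy \<Rightarrow> 'a banach_copy" is sgn .
lift_definition dist_banach_copy :: "'a banach_copy \<Rightarrow> 'a banach_copy \<Rightarrow> real" is dist .
definition uniformity_banach_copy :: "('a banach_copy \<times> 'a banach_copy) filter"
  where "uniformity_banach_copy = (INF e\<in>{0 <..}. principal {(x, y). dist x y < e})"
definition open_banach_copy :: "'a banach_copy set \<Rightarrow> bool"
  where "open_banach_copy U \<longleftrightarrow> (\<forall>x\<in>U. eventually (\<lambda>(x', y). x' = x \<longrightarrow> y \<in> U) uniformity)"

instance
proof
  fix x y z :: "'a banach_copy" and a b :: real and U :: "'a banach_copy set"
  show "(uniformity :: ('a banach_copy \<times> 'a banach_copy) filter)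
      = (INF e\<in>{0 <..}. principal {(x, y). dist x y < e})"
    by (rule uniformity_banach_copy_def)
  show "open U \<longleftrightarrow> (\<forall>x\<in>U. eventually (\<lambda>(x', y). x' = x \<longrightarrow> y \<in> U) uniformity)"
    by (rule open_banach_copy_def)
qed (transfer, simp add: algebra_simps sgn_div_norm dist_norm norm_triangle_ineq)+

end

lemma bounded_linear_of_copy: "bounded_linear of_copy"
  by (rule bounded_linear_intro[where K = 1]; transfer) auto

lemma norm_of_copy_diff: "norm (of_copy x - of_copy y) = norm (x - y)"
  by transfer simp

instance banach_copy :: ("{real_normed_vector, complete_space}") banach
proof
  fix X :: "nat \<Rightarrow> 'a banach_copy"
  assume "Cauchy X"
  then have "Cauchy (\<lambda>n. of_copy (X n))"
    by (simp add: Cauchy_iff norm_of_copy_diff)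
  then obtain l where "(\<lambda>n. of_copy (X n)) \<longlonglongrightarrow> l"
    using Cauchy_convergent convergent_def by blast
  then have "X \<longlonglongrightarrow> to_copy l"
    by (simp add: LIMSEQ_iff flip: norm_of_copy_diff) (simp add: to_copy_inverse)
  then show "convergent X"
    by (auto simp: convergent_def)
qed

section \<open>Global solvability of Lipschitz differential equations\<close>

text \<open>Functions are weighted by \<open>exp (- 2 L t)\<close>, which turns the integral operator into a
  contraction on the bounded continuous functions on the whole half-line.\<close>

lemma picard_global_banach:
  fixes g :: "real \<Rightarrow> 'a::banach \<Rightarrow> 'a"
  assumes cont: "continuous_on ({0..} \<times> UNIV) (\<lambda>(t, u). g t u)"
    and lip: "\<And>t u v. 0 \<le> t \<Longrightarrow> norm (g t u - g t v) \<le> L * norm (u - v)"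
    and bound: "\<And>t. 0 \<le> t \<Longrightarrow> norm (g t 0) \<le> M"
    and L: "0 < L"
  shows "\<exists>v. v 0 = v0 \<and> (\<forall>t\<ge>0. (v has_vector_derivative g t (v t)) (at t within {0..}))"
proof -
  \<comment> \<open>Integrating the weight produces the factor \<open>L / K\<close> in the
    contraction estimate, and this choice makes it \<open>1 / 2\<close>.\<close>
  define K where "K = 2 * L"
  have K: "0 < K" using L by (simp add: K_def)
  have M: "0 \<le> M" using bound[of 0] norm_ge_zero order_trans by blast
  \<comment> \<open>The unknown \<open>u\<close> is the weighted function; multiplying it by
    \<open>exp (K * s)\<close> restores the candidate solution before \<open>g\<close> is
    applied.\<close>
  define G where "G u s = g s (exp (K * s) *\<^sub>R apply_bcontfun u s)" for u :: "real \<Rightarrow>\<^sub>C 'a" and s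
  have G_cont: "continuous_on {0..b} (G u)" for u b
  proof -
    have *: "continuous_on {0..b} (\<lambda>s. (s, exp (K * s) *\<^sub>R apply_bcontfun u s))"
      by (intro continuous_intros) simp
    show ?thesis
      unfolding G_def using continuous_on_compose2[OF cont *] by (simp add: image_subset_iff)
  qed
  have exp_int: "((\<lambda>s. c * exp (K * s)) has_integral c * ((exp (K * t) - 1) / K)) {0..t}" if "0 \<le> t" for c t
  proof -
    have "((\<lambda>s. exp (K * s)) has_integral (exp (K * t) / K - exp (K * 0) / K)) {0..t}"
      using that K by (intro fundamental_theorem_of_calculus)
        (auto intro!: derivative_eq_intros simp flip: has_real_derivative_iff_has_vector_derivative)
    from has_integral_mult_right[OF this, of c] show ?thesis
      by (simp add: diff_divide_distrib)
  qed
  \<comment> \<open>Elements of the type of bounded continuous functions live on the whole real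
    line. Replacing \<open>t\<close> by \<open>max 0 t\<close> extends the weighted integral
    operator to negative times by the constant \<open>v0\<close>.\<close>
  define P where "P u t = exp (- (K * max 0 t)) *\<^sub>R (v0 + integral {0..max 0 t} (G u))" for u t
  have int_cont: "continuous_on {0..b} (\<lambda>t. integral {0..t} (G u))" for u b
    using G_cont by (intro indefinite_integral_continuous_1 integrable_continuous_real)
  have int_cont': "continuous_on UNIV (\<lambda>t. integral {0..max 0 t} (G u))" for u
  proof -
    have "isCont (\<lambda>t. integral {0..max 0 t} (G u)) t" for t
    proof -
      have "continuous_on {..<\<bar>t\<bar> + 1} (\<lambda>t. integral {0..max 0 t} (G u))"
        by (intro continuous_on_compose2[OF int_cont[of "\<bar>t\<bar> + 1" u], of _ "max 0"] continuous_intros) auto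
      then show ?thesis
        by (rule continuous_on_interior) (simp add: interior_open)
    qed
    then show ?thesis
      by (simp add: continuous_at_imp_continuous_on)
  qed
  have P_cont: "continuous_on UNIV (P u)" for u
    unfolding P_def by (intro continuous_intros int_cont')
  have P_bound: "norm (P u t) \<le> norm v0 + (M + L * norm u) / K" for u t
  proof -
    define s where "s = max 0 t"
    have s: "0 \<le> s" by (simp add: s_def)
    have "norm (integral {0..s} (G u)) \<le> integral {0..s} (\<lambda>r. (M + L * norm u) * exp (K * r))"
    proof (rule integral_norm_bound_integral)
      fix r assume "r \<in> {0..s}"
      then have r: "0 \<le> r" by simp
      have "norm (G u r) \<le> norm (g r 0) + L * norm (exp (K * r) *\<^sub>R apply_bcontfun u r - 0)"
        unfolding G_def using lip[OF r] norm_triangle_sub order_trans by (meson add_left_mono)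
      also have "\<dots> \<le> M * exp (K * r) + L * (exp (K * r) * norm u)"
        using bound[OF r] L K r norm_bounded[of u r] mult_left_mono[of 1 "exp (K * r)" M] M
        by (intro add_mono) auto
      finally show "norm (G u r) \<le> (M + L * norm u) * exp (K * r)"
        by (simp add: algebra_simps)
    qed (use G_cont exp_int[OF s] in \<open>auto intro!: integrable_continuous_real continuous_intros\<close>)
    also have "\<dots> = (M + L * norm u) * ((exp (K * s) - 1) / K)"
      using exp_int[OF s] by (rule integral_unique)
    also have "\<dots> \<le> (M + L * norm u) * (exp (K * s) / K)"
      using K L M by (intro mult_left_mono divide_right_mono) auto
    finally have "norm (v0 + integral {0..s} (G u)) \<le> norm v0 * 1 + (M + L * norm u) * (exp (K * s) / K)"
      using norm_triangle_ineq[of v0 "integral {0..s} (G u)"] by simp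
    also have "\<dots> \<le> norm v0 * exp (K * s) + (M + L * norm u) * (exp (K * s) / K)"
      using K s by (intro add_mono[OF mult_left_mono order_refl]) auto
    also have "\<dots> = exp (K * s) * (norm v0 + (M + L * norm u) / K)"
      by (simp add: algebra_simps)
    finally have "norm (v0 + integral {0..s} (G u)) \<le> exp (K * s) * (norm v0 + (M + L * norm u) / K)" .
    moreover have "norm (P u t) = norm (v0 + integral {0..s} (G u)) / exp (K * s)"
      unfolding P_def s_def[symmetric] by (simp add: exp_minus divide_inverse mult.commute)
    ultimately show ?thesis
      by (simp add: pos_divide_le_eq mult.commute)
  qed
  \<comment> \<open>\<open>Bcontfun\<close> is meaningful only on bounded continuous functions;
    \<open>P_cont\<close> and \<open>P_bound\<close> ensure that \<open>Q u\<close> really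
    represents \<open>P u\<close>.\<close>
  define Q where "Q u = Bcontfun (P u)" for u
  have Q: "apply_bcontfun (Q u) = P u" for u
    unfolding Q_def using P_cont P_bound by (intro Bcontfun_inverse bcontfun_normI)
  have contr: "dist (Q u) (Q v) \<le> 1 / 2 * dist u v" for u v
  proof (rule dist_bound)
    fix t :: real
    define s where "s = max 0 t"
    have s: "0 \<le> s" by (simp add: s_def)
    have "norm (integral {0..s} (G u) - integral {0..s} (G v)) = norm (integral {0..s} (\<lambda>r. G u r - G v r))"
      using G_cont by (subst integral_diff) (auto intro!: integrable_continuous_real)
    also have "\<dots> \<le> integral {0..s} (\<lambda>r. (L * dist u v) * exp (K * r))"
    proof (rule integral_norm_bound_integral)
      fix r assume "r \<in> {0..s}"
      then have r: "0 \<le> r" by simp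
      have "norm (G u r - G v r)
          \<le> L * norm (exp (K * r) *\<^sub>R apply_bcontfun u r - exp (K * r) *\<^sub>R apply_bcontfun v r)"
        unfolding G_def by (rule lip[OF r])
      also have "\<dots> = L * (exp (K * r) * dist (apply_bcontfun u r) (apply_bcontfun v r))"
        by (simp add: dist_norm flip: scaleR_diff_right)
      also have "\<dots> \<le> L * (exp (K * r) * dist u v)"
        using L dist_bounded[of u r v] by (intro mult_left_mono) auto
      finally show "norm (G u r - G v r) \<le> (L * dist u v) * exp (K * r)"
        by (simp add: algebra_simps)
    qed (use G_cont exp_int[OF s] in \<open>auto intro!: integrable_continuous_real continuous_intros\<close>)
    also have "\<dots> = (L * dist u v) * ((exp (K * s) - 1) / K)"
      using exp_int[OF s] by (rule integral_unique)
    also have "\<dots> \<le> (L * dist u v) * (exp (K * s) / K)"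
      using K L by (intro mult_left_mono divide_right_mono) auto
    also have "\<dots> = exp (K * s) * (1 / 2 * dist u v)"
      using L by (simp add: K_def)
    finally have "norm (integral {0..s} (G u) - integral {0..s} (G v)) \<le> exp (K * s) * (1 / 2 * dist u v)" .
    moreover have "exp (K * s) * dist (P u t) (P v t) = norm (integral {0..s} (G u) - integral {0..s} (G v))"
      unfolding P_def s_def[symmetric] by (simp add: dist_norm exp_minus flip: scaleR_diff_right)
    ultimately have "exp (K * s) * dist (P u t) (P v t) \<le> exp (K * s) * (1 / 2 * dist u v)"
      by metis
    then show "dist (apply_bcontfun (Q u) t) (apply_bcontfun (Q v) t) \<le> 1 / 2 * dist u v"
      unfolding Q by (subst (asm) mult_le_cancel_left_pos) auto
  qed
  obtain u where u: "Q u = u"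
    using banach_fix_type[of "1 / 2" Q] contr by auto
  define v where "v t = exp (K * t) *\<^sub>R apply_bcontfun u t" for t
  have v: "v t = v0 + integral {0..t} (G u)" if "0 \<le> t" for t
  proof -
    have "v t = exp (K * t) *\<^sub>R P u t"
      unfolding v_def by (metis Q u)
    then show ?thesis
      using that by (simp add: P_def flip: exp_add)
  qed
  have "(v has_vector_derivative g t (v t)) (at t within {0..})" if t: "0 \<le> t" for t
  proof -
    have "((\<lambda>t. integral {0..t} (G u)) has_vector_derivative G u t) (at t within {0..t + 1})"
      using G_cont t by (intro integral_has_vector_derivative) auto
    then have "((\<lambda>t. v0 + integral {0..t} (G u)) has_vector_derivative G u t) (at t within {0..t + 1})"
      by (auto intro!: derivative_eq_intros)
    moreover have "G u t = g t (v t)"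
      by (simp add: G_def v_def)
    \<comment> \<open>The fundamental theorem is available on compact intervals. Ending the interval
      strictly after \<open>t\<close> makes it agree with the half-line near
      \<open>t\<close>.\<close>
    moreover have "at t within {0..t + 1} = at t within {0..}"
      by (rule at_within_nhd[of _ "{..<t + 1}"]) auto
    ultimately have "((\<lambda>t. v0 + integral {0..t} (G u)) has_vector_derivative g t (v t)) (at t within {0..})"
      by simp
    then show ?thesis
      using t v by (intro has_vector_derivative_transform[of t "{0..}" v]) auto
  qed
  moreover have "v 0 = v0"
    using v[of 0] by simp
  ultimately show ?thesis by blast
qed

text \<open>The maps \<open>to_copy\<close> and \<open>of_copy\<close> are linear isometries, so the
  equation can be solved in the copied type, where the integral exists, and its solution carried
  back.\<close>

lemma picard_global:
  fixes g :: "real \<Rightarrow> 'a::{real_normed_vector, complete_space} \<Rightarrow> 'a"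
  assumes cont: "continuous_on ({0..} \<times> UNIV) (\<lambda>(t, u). g t u)"
    and lip: "\<And>t u v. 0 \<le> t \<Longrightarrow> norm (g t u - g t v) \<le> L * norm (u - v)"
    and bound: "\<And>t. 0 \<le> t \<Longrightarrow> norm (g t 0) \<le> M"
    and L: "0 < L"
  shows "\<exists>v. v 0 = v0 \<and> (\<forall>t\<ge>0. (v has_vector_derivative g t (v t)) (at t within {0..}))"
proof -
  interpret of_copy: bounded_linear of_copy
    by (rule bounded_linear_of_copy)
  have norm_to_copy: "norm (to_copy x) = norm x" for x :: 'a
    by transfer simp
  have bl_to_copy: "bounded_linear (to_copy :: 'a \<Rightarrow> _)"
    by (rule bounded_linear_intro[where K = 1]; transfer) auto
  define h where "h t u = to_copy (g t (of_copy u))" for t u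
  have of_h: "of_copy (h t u) = g t (of_copy u)" for t u
    by (simp add: h_def to_copy_inverse)
  have "\<exists>v. v 0 = to_copy v0 \<and> (\<forall>t\<ge>0. (v has_vector_derivative h t (v t)) (at t within {0..}))"
  proof (rule picard_global_banach[OF _ _ _ L])
    have *: "continuous_on ({0..} \<times> UNIV) (\<lambda>p. (fst p, of_copy (snd p)))"
      by (intro continuous_intros bounded_linear.continuous_on[OF bounded_linear_of_copy])
    have "continuous_on ({0..} \<times> UNIV) (\<lambda>p. g (fst p) (of_copy (snd p)))"
      using continuous_on_compose2[OF cont *] by (simp add: image_subset_iff)
    then show "continuous_on ({0..} \<times> UNIV) (\<lambda>(t, u). h t u)"
      unfolding h_def case_prod_unfold by (rule bounded_linear.continuous_on[OF bl_to_copy])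
    show "norm (h t u - h t v) \<le> L * norm (u - v)" if "0 \<le> t" for t u v
      using lip[OF that, of "of_copy u" "of_copy v"] by (simp add: norm_of_copy_diff of_h flip: norm_of_copy_diff[of "h t u"])
    show "norm (h t 0) \<le> M" if "0 \<le> t" for t
      using bound[OF that] by (simp add: h_def norm_to_copy of_copy.zero)
  qed
  then obtain v where v: "v 0 = to_copy v0"
    "\<And>t. 0 \<le> t \<Longrightarrow> (v has_vector_derivative h t (v t)) (at t within {0..})" by blast
  show ?thesis
  proof (intro exI[of _ "\<lambda>t. of_copy (v t)"] conjI allI impI)
    show "of_copy (v 0) = v0"
      by (simp add: v to_copy_inverse)
    show "((\<lambda>t. of_copy (v t)) has_vector_derivative g t (of_copy (v t))) (at t within {0..})"
      if "0 \<le> t" for t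
      using of_copy.has_vector_derivative[OF v(2)[OF that]] by (simp add: of_h)
  qed
qed

section \<open>Bijectivity of strongly monotone Lipschitz maps\<close>

text \<open>Injectivity is immediate from strong monotonicity. For surjectivity,
  \<open>f u = v\<close> is read as a fixed point equation for the damped step from \<open>u\<close>
  to \<open>u - \<tau> *\<^sub>R (f u - v)\<close>, which contracts for a small enough step
  size.\<close>

lemma strongly_monotone_bij:
  fixes f :: "'a::{real_inner, complete_space} \<Rightarrow> 'a"
  assumes c: "0 < c"
    and mono: "\<And>u v. c * (norm (u - v))\<^sup>2 \<le> inner (f u - f v) (u - v)"
    and lip: "\<And>u v. norm (f u - f v) \<le> L * norm (u - v)"
  shows "bij f"
proof (rule bijI)
  show "inj f"
  proof (rule injI)
    fix u v assume "f u = f v"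
    then have "c * (norm (u - v))\<^sup>2 \<le> 0"
      using mono[of u v] by simp
    then show "u = v"
      using c by (simp add: mult_le_0_iff)
  qed
  show "surj f"
  proof (rule surjI)
    \<comment> \<open>Enlarging the Lipschitz constant to at least \<open>c\<close> keeps
      \<open>M\<close> positive and the radicand in \<open>q\<close> nonnegative.\<close>
    define M where "M = max L c"
    have M: "c \<le> M" "0 < M" and lip_M: "norm (f u - f v) \<le> M * norm (u - v)" for u v
      using c order_trans[OF lip[of u v] mult_right_mono] by (auto simp: M_def)
    \<comment> \<open>This step size minimizes the quadratic
      \<open>1 - 2 * \<tau> * c + \<tau>\<^sup>2 * M\<^sup>2\<close>; its minimum is the square of
      \<open>q\<close>.\<close>
    define \<tau> where "\<tau> = c / M\<^sup>2"
    define q where "q = sqrt (1 - c\<^sup>2 / M\<^sup>2)"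
    have "c\<^sup>2 / M\<^sup>2 \<le> 1" "0 < c\<^sup>2 / M\<^sup>2"
      using c M by (auto simp: power_mono)
    then have q: "0 \<le> q" "q < 1" and q2: "q\<^sup>2 = 1 - c\<^sup>2 / M\<^sup>2"
      by (auto simp: q_def)
    fix v
    have "norm ((u - \<tau> *\<^sub>R (f u - v)) - (w - \<tau> *\<^sub>R (f w - v))) \<le> q * norm (u - w)" for u w
    proof (rule power2_le_imp_le)
      have "(norm ((u - \<tau> *\<^sub>R (f u - v)) - (w - \<tau> *\<^sub>R (f w - v))))\<^sup>2
          = (norm ((u - w) - \<tau> *\<^sub>R (f u - f w)))\<^sup>2"
        by (simp add: algebra_simps)
      also have "\<dots> = (norm (u - w))\<^sup>2 - 2 * \<tau> * inner (f u - f w) (u - w) + \<tau>\<^sup>2 * (norm (f u - f w))\<^sup>2"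
        unfolding power2_norm_eq_inner
        by (simp add: inner_diff_left inner_diff_right inner_commute power2_eq_square algebra_simps)
      also have "\<dots> \<le> (norm (u - w))\<^sup>2 - 2 * \<tau> * (c * (norm (u - w))\<^sup>2) + \<tau>\<^sup>2 * (M * norm (u - w))\<^sup>2"
        using c M lip_M[of u w]
        by (intro add_mono diff_mono mult_left_mono mono power_mono) (auto simp: \<tau>_def)
      also have "\<dots> = (1 - 2 * \<tau> * c + \<tau>\<^sup>2 * M\<^sup>2) * (norm (u - w))\<^sup>2"
        by (simp add: algebra_simps)
      also have "1 - 2 * \<tau> * c + \<tau>\<^sup>2 * M\<^sup>2 = q\<^sup>2"
        unfolding q2 using M by (simp add: \<tau>_def field_simps power2_eq_square)
      finally show "(norm ((u - \<tau> *\<^sub>R (f u - v)) - (w - \<tau> *\<^sub>R (f w - v))))\<^sup>2 \<le> (q * norm (u - w))\<^sup>2"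
        by (simp add: power_mult_distrib)
    qed (use q in simp)
    then obtain u where "u - \<tau> *\<^sub>R (f u - v) = u"
      using banach_fix_type[of q "\<lambda>u. u - \<tau> *\<^sub>R (f u - v)"] q by (auto simp: dist_norm)
    then have "f u = v"
      using c M by (simp add: \<tau>_def)
    then show "f (SOME u. f u = v) = v"
      by (rule someI)
  qed
qed

section \<open>Monotonicity and Taylor estimates for the operator\<close>

locale monotone_operator =
  fixes F :: "'a::{real_inner, complete_space} \<Rightarrow> 'a"
    and F' :: "'a \<Rightarrow> 'a \<Rightarrow>\<^sub>L 'a"
    and F'' :: "'a \<Rightarrow> 'a \<Rightarrow>\<^sub>L ('a \<Rightarrow>\<^sub>L 'a)"
    and N1 N2 :: real and z0 :: 'a
  assumes F_deriv: "\<And>h. (F has_derivative blinfun_apply (F' h)) (at h)"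
    and F_deriv2: "\<And>h. (F' has_derivative blinfun_apply (F'' h)) (at h)"
    and F'_nonneg: "\<And>h \<xi>. inner (F' h \<xi>) \<xi> \<ge> 0"
    and F'_bound: "\<And>h. norm (F' h) \<le> N1"
    and F''_bound: "\<And>h. norm (F'' h) \<le> N2"
begin

lemma F_lipschitz: "norm (F u - F v) \<le> N1 * norm (u - v)"
  using F_deriv F'_bound
  by (intro differentiable_bound[where S = UNIV and f' = "\<lambda>h. blinfun_apply (F' h)"])
    (auto simp flip: norm_blinfun.rep_eq)

lemma F'_lipschitz: "norm (F' u - F' v) \<le> N2 * norm (u - v)"
  using F_deriv2 F''_bound
  by (intro differentiable_bound[where S = UNIV and f' = "\<lambda>h. blinfun_apply (F'' h)"])
    (auto simp flip: norm_blinfun.rep_eq)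

text \<open>Pairing with a fixed vector \<open>e\<close> gives a real function of one variable, so
  that the sign of its derivative controls its growth.\<close>

lemma F_along_segment:
  "((\<lambda>s. inner (F (v + s *\<^sub>R d)) e) has_real_derivative inner (F' (v + s *\<^sub>R d) d) e) (at s within S)"
proof -
  have "((\<lambda>s. F (v + s *\<^sub>R d)) has_derivative (\<lambda>h. F' (v + s *\<^sub>R d) (h *\<^sub>R d))) (at s within S)"
    by (rule has_derivative_compose[OF _ F_deriv, of "\<lambda>s. v + s *\<^sub>R d"]) (auto intro!: derivative_eq_intros)
  from has_derivative_inner_left[OF this, of e] show ?thesis
    by (simp add: has_field_derivative_def blinfun.scaleR_right mult.commute[of _ "inner _ _"])
qed

lemma F_monotone: "0 \<le> inner (F u - F v) (u - v)"
proof -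
  have "inner (F (v + 0 *\<^sub>R (u - v))) (u - v) \<le> inner (F (v + 1 *\<^sub>R (u - v))) (u - v)"
  proof (rule DERIV_nonneg_imp_nondecreasing[of 0 1 "\<lambda>s. inner (F (v + s *\<^sub>R (u - v))) (u - v)"])
    show "\<exists>y. DERIV (\<lambda>s. inner (F (v + s *\<^sub>R (u - v))) (u - v)) s :> y \<and> 0 \<le> y" for s
      using F_along_segment F'_nonneg by blast
  qed simp
  then show ?thesis
    by (simp add: inner_diff_left)
qed

text \<open>Pairing with the remainder \<open>r\<close> itself reduces the estimate to the scalar
  function \<open>\<phi>\<close>, which is nonincreasing because \<open>F'\<close> is Lipschitz.
  Comparing \<open>\<phi>\<close> at 0 and 1 bounds the square of \<open>norm r\<close> by the
  desired constant times \<open>norm r\<close>, and one factor cancels.\<close>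

lemma F_taylor: "norm (F u - F v - F' v (u - v)) \<le> N2 / 2 * (norm (u - v))\<^sup>2"
proof -
  define d where "d = u - v"
  define r where "r = F u - F v - F' v d"
  define \<phi> where "\<phi> s = inner (F (v + s *\<^sub>R d)) r - s * inner (F' v d) r - N2 / 2 * s\<^sup>2 * (norm d)\<^sup>2 * norm r" for s
  have "\<phi> 1 \<le> \<phi> 0"
  proof (rule DERIV_nonpos_imp_nonincreasing[of 0 1 \<phi>])
    fix s :: real assume s: "0 \<le> s" "s \<le> 1"
    have "inner (F' (v + s *\<^sub>R d) d) r - inner (F' v d) r = inner ((F' (v + s *\<^sub>R d) - F' v) d) r"
      by (simp add: blinfun.diff_left inner_diff_left)
    also have "\<dots> \<le> norm ((F' (v + s *\<^sub>R d) - F' v) d) * norm r"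
      by (rule norm_cauchy_schwarz)
    also have "\<dots> \<le> (N2 * norm (s *\<^sub>R d) * norm d) * norm r"
      using F'_lipschitz[of "v + s *\<^sub>R d" v]
      by (intro mult_right_mono order_trans[OF norm_blinfun]) auto
    finally have "inner (F' (v + s *\<^sub>R d) d) r - inner (F' v d) r \<le> N2 * s * (norm d)\<^sup>2 * norm r"
      using s by (simp add: power2_eq_square mult_ac)
    moreover have "(\<phi> has_real_derivative inner (F' (v + s *\<^sub>R d) d) r - inner (F' v d) r - N2 * s * (norm d)\<^sup>2 * norm r) (at s)"
      unfolding \<phi>_def by (intro DERIV_diff F_along_segment) (auto intro!: derivative_eq_intros)
    ultimately show "\<exists>y. DERIV \<phi> s :> y \<and> y \<le> 0"
      by force
  qed simp
  then have "inner r r \<le> N2 / 2 * (norm d)\<^sup>2 * norm r"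
    by (simp add: \<phi>_def d_def r_def inner_diff_left)
  then have "norm r * norm r \<le> N2 / 2 * (norm d)\<^sup>2 * norm r"
    by (simp add: dot_square_norm power2_eq_square)
  moreover have "0 \<le> N2"
    using F''_bound[of v] norm_ge_zero order_trans by blast
  ultimately have "norm r \<le> N2 / 2 * (norm d)\<^sup>2"
    by (cases "norm r = 0") auto
  then show ?thesis
    by (simp add: r_def d_def)
qed

section \<open>The regularized operator, its derivative and their inverses\<close>

definition reg :: "real \<Rightarrow> 'a \<Rightarrow> 'a" where
  "reg e u = F u + e *\<^sub>R (u - z0)"

definition reg_deriv :: "real \<Rightarrow> 'a \<Rightarrow> 'a \<Rightarrow> 'a" where
  "reg_deriv e h = blinfun_apply (F' h + e *\<^sub>R id_blinfun)"

text \<open>For \<open>e > 0\<close> this is the inverse of \<open>F + e I\<close> applied to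
  \<open>v + e z0\<close>. At \<open>v = 0\<close> it gives the regularized solution, and at the
  residual of a point it recovers that point.\<close>

definition resolvent :: "real \<Rightarrow> 'a \<Rightarrow> 'a" where
  "resolvent e = inv (reg e)"

lemma reg_deriv_apply: "reg_deriv e h \<xi> = F' h \<xi> + e *\<^sub>R \<xi>"
  by (simp add: reg_deriv_def blinfun.add_left blinfun.scaleR_left)

lemma reg_strongly_monotone: "e * (norm (u - v))\<^sup>2 \<le> inner (reg e u - reg e v) (u - v)"
proof -
  have "reg e u - reg e v = (F u - F v) + e *\<^sub>R (u - v)"
    by (simp add: reg_def algebra_simps)
  then show ?thesis
    using F_monotone[of u v] by (simp add: inner_add_left dot_square_norm)
qed

text \<open>Strong monotonicity and the Cauchy-Schwarz inequality, after one factor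
  \<open>norm (u - v)\<close> is cancelled. For \<open>e > 0\<close> this is the source of the
  Lipschitz constant \<open>1 / e\<close> of the resolvent.\<close>

lemma reg_expanding: "e * norm (u - v) \<le> norm (reg e u - reg e v)"
proof (cases "u = v")
  case False
  have "e * norm (u - v) * norm (u - v) \<le> norm (reg e u - reg e v) * norm (u - v)"
    using order_trans[OF reg_strongly_monotone norm_cauchy_schwarz] by (simp add: power2_eq_square mult_ac)
  then show ?thesis
    using False by (simp add: mult_le_cancel_right)
qed simp

lemma bij_reg:
  assumes "0 < e"
  shows "bij (reg e)"
proof (rule strongly_monotone_bij[OF assms reg_strongly_monotone])
  fix u v
  have "reg e u - reg e v = (F u - F v) + e *\<^sub>R (u - v)"
    by (simp add: reg_def algebra_simps)
  then show "norm (reg e u - reg e v) \<le> (N1 + e) * norm (u - v)"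
    using norm_triangle_ineq[of "F u - F v" "e *\<^sub>R (u - v)"] F_lipschitz[of u v] assms
    by (simp add: distrib_right)
qed

lemma reg_deriv_strongly_monotone: "e * (norm \<xi>)\<^sup>2 \<le> inner (reg_deriv e h \<xi>) \<xi>"
  using F'_nonneg[of h \<xi>] by (simp add: reg_deriv_apply inner_add_left dot_square_norm)

lemma reg_deriv_expanding: "e * norm \<xi> \<le> norm (reg_deriv e h \<xi>)"
proof (cases "\<xi> = 0")
  case False
  have "e * norm \<xi> * norm \<xi> \<le> norm (reg_deriv e h \<xi>) * norm \<xi>"
    using order_trans[OF reg_deriv_strongly_monotone norm_cauchy_schwarz] by (simp add: power2_eq_square mult_ac)
  then show ?thesis
    using False by (simp add: mult_le_cancel_right)
qed simp

lemma linear_reg_deriv: "linear (reg_deriv e h)"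
  unfolding reg_deriv_def by (rule bounded_linear.linear[OF blinfun.bounded_linear_right])

lemma reg_deriv_diff: "reg_deriv e h u - reg_deriv e h v = reg_deriv e h (u - v)"
  by (simp add: linear_diff[OF linear_reg_deriv])

lemma bij_reg_deriv:
  assumes "0 < e"
  shows "bij (reg_deriv e h)"
proof (rule strongly_monotone_bij[OF assms])
  show "e * (norm (u - v))\<^sup>2 \<le> inner (reg_deriv e h u - reg_deriv e h v) (u - v)" for u v
    unfolding reg_deriv_diff by (rule reg_deriv_strongly_monotone)
  show "norm (reg_deriv e h u - reg_deriv e h v) \<le> norm (F' h + e *\<^sub>R id_blinfun) * norm (u - v)" for u v
    unfolding reg_deriv_diff unfolding reg_deriv_def by (rule norm_blinfun)
qed

lemma reg_deriv_inv: "0 < e \<Longrightarrow> reg_deriv e h (inv (reg_deriv e h) \<eta>) = \<eta>"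
  by (simp add: bij_reg_deriv bij_is_surj surj_f_inv_f)

lemma inv_reg_deriv: "0 < e \<Longrightarrow> inv (reg_deriv e h) (reg_deriv e h \<xi>) = \<xi>"
  by (simp add: bij_reg_deriv bij_is_inj)

lemma inv_reg_deriv_eqI: "0 < e \<Longrightarrow> reg_deriv e h \<xi> = \<eta> \<Longrightarrow> inv (reg_deriv e h) \<eta> = \<xi>"
  using inv_reg_deriv by blast

lemma norm_inv_reg_deriv:
  assumes "0 < e"
  shows "norm (inv (reg_deriv e h) \<eta>) \<le> norm \<eta> / e"
  using reg_deriv_expanding[of e "inv (reg_deriv e h) \<eta>" h] assms
  by (simp add: reg_deriv_inv field_simps)

lemma bounded_linear_inv_reg_deriv:
  assumes "0 < e"
  shows "bounded_linear (inv (reg_deriv e h))"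
proof (rule bounded_linear_intro)
  show "inv (reg_deriv e h) (u + v) = inv (reg_deriv e h) u + inv (reg_deriv e h) v" for u v
    by (rule inv_reg_deriv_eqI[OF assms]) (simp only: linear_add[OF linear_reg_deriv] reg_deriv_inv[OF assms])
  show "inv (reg_deriv e h) (r *\<^sub>R u) = r *\<^sub>R inv (reg_deriv e h) u" for r u
    by (rule inv_reg_deriv_eqI[OF assms]) (simp only: linear_scale[OF linear_reg_deriv] reg_deriv_inv[OF assms])
  show "norm (inv (reg_deriv e h) \<eta>) \<le> norm \<eta> * (1 / e)" for \<eta>
    using norm_inv_reg_deriv[OF assms] by simp
qed

lemma reg_resolvent: "0 < e \<Longrightarrow> reg e (resolvent e v) = v"
  by (simp add: resolvent_def bij_reg bij_is_surj surj_f_inv_f)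

lemma resolvent_reg: "0 < e \<Longrightarrow> resolvent e (reg e u) = u"
  by (simp add: resolvent_def bij_reg bij_is_inj)

lemma resolvent_lipschitz:
  assumes "0 < e"
  shows "norm (resolvent e u - resolvent e v) \<le> norm (u - v) / e"
  using reg_expanding[of e "resolvent e u" "resolvent e v"] assms
  by (simp add: reg_resolvent field_simps)

lemma regularized_solution_eq:
  assumes "0 < e"
  shows "regularized_solution F z0 e = resolvent e 0"
  unfolding regularized_solution_def reg_def[symmetric]
proof (rule the_equality)
  show "reg e (resolvent e 0) = 0"
    by (rule reg_resolvent[OF assms])
  show "\<xi> = resolvent e 0" if "reg e \<xi> = 0" for \<xi>
    using resolvent_reg[OF assms, of \<xi>] that by simp
qed

lemma newton_field_eq:
  "newton_field F F' \<epsilon> z0 h t = - inv (reg_deriv (\<epsilon> t) h) (reg (\<epsilon> t) h)"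
  by (simp add: newton_field_def reg_def reg_deriv_def)

section \<open>Dependence of the resolvent on its argument and parameter\<close>

text \<open>The value \<open>?h\<close> at the base point satisfies the equation with a nearby
  parameter up to a shift of the right-hand side that is linear in the parameter change. Expansion
  at the nearby parameter turns this defect into a bound on the displacement.\<close>

lemma isCont_resolvent:
  assumes e: "0 < e"
  shows "isCont (\<lambda>p. resolvent (snd p) (fst p)) (v, e)"
proof -
  let ?h = "resolvent e v"
  let ?b = "\<lambda>p::'a \<times> real. norm ((fst p - v) - (snd p - e) *\<^sub>R (?h - z0)) / snd p"
  have ev: "\<forall>\<^sub>F p in at (v, e). 0 < snd p"
  proof -
    have "(snd \<longlongrightarrow> snd (v, e)) (at (v, e))" by (intro tendsto_intros)
    from order_tendstoD(1)[OF this, of 0] show ?thesis using e by simp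
  qed
  have "((\<lambda>p. resolvent (snd p) (fst p) - ?h) \<longlongrightarrow> 0) (at (v, e))"
  proof (rule Lim_null_comparison)
    show "\<forall>\<^sub>F p in at (v, e). norm (resolvent (snd p) (fst p) - ?h) \<le> ?b p"
      using ev
    proof eventually_elim
      case (elim p)
      have "reg (snd p) ?h = v + (snd p - e) *\<^sub>R (?h - z0)"
        using reg_resolvent[OF e, of v] by (simp add: reg_def algebra_simps)
      moreover have "norm (resolvent (snd p) (fst p) - ?h) \<le> norm (fst p - reg (snd p) ?h) / snd p"
        using reg_expanding[of "snd p" "resolvent (snd p) (fst p)" ?h] elim
        by (simp add: reg_resolvent field_simps)
      ultimately show ?case
        by (simp add: diff_diff_eq)
    qed
    have "(?b \<longlongrightarrow> norm ((fst (v, e) - v) - (snd (v, e) - e) *\<^sub>R (?h - z0)) / snd (v, e)) (at (v, e))"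
      using e by (intro tendsto_intros) auto
    then show "(?b \<longlongrightarrow> 0) (at (v, e))" by simp
  qed
  then show ?thesis
    by (simp add: isCont_def LIM_zero_iff)
qed

text \<open>Carrying the parameter along as a second component makes \<open>\<Psi>\<close> a map of
  the product space into itself with inverse \<open>\<Psi>i\<close>. Its derivative is triangular,
  hence explicitly invertible, and the derivative rule for inverses applies once
  \<open>\<Psi>i\<close> is known to be continuous.\<close>

lemma resolvent_has_derivative:
  fixes v
  assumes e: "0 < e"
  defines "h \<equiv> resolvent e v"
  shows "((\<lambda>p. resolvent (snd p) (fst p)) has_derivative
      (\<lambda>q. inv (reg_deriv e h) (fst q - snd q *\<^sub>R (h - z0)))) (at (v, e))"
proof -
  let ?B = "inv (reg_deriv e h)"
  define \<Psi> where "\<Psi> p = (reg (snd p) (fst p), snd p)" for p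
  define \<Psi>i where "\<Psi>i p = (resolvent (snd p) (fst p), snd p)" for p
  have "(\<Psi>i has_derivative (\<lambda>q. (?B (fst q - snd q *\<^sub>R (h - z0)), snd q))) (at (v, e))"
  proof (rule has_derivative_inverse_basic[where f = \<Psi>
        and f' = "\<lambda>q. (reg_deriv e h (fst q) + snd q *\<^sub>R (h - z0), snd q)" and T = "UNIV \<times> {0<..}"])
    have "((\<lambda>p. F (fst p)) has_derivative (\<lambda>q. F' h (fst q))) (at (h, e))"
      using has_derivative_compose[OF bounded_linear_imp_has_derivative[OF bounded_linear_fst] F_deriv, of "(h, e)" UNIV]
      by simp
    then have "(\<Psi> has_derivative (\<lambda>q. (F' h (fst q) + (e *\<^sub>R fst q + snd q *\<^sub>R (h - z0)), snd q))) (at (h, e))"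
      unfolding \<Psi>_def reg_def by (auto intro!: derivative_eq_intros)
    then show "(\<Psi> has_derivative (\<lambda>q. (reg_deriv e h (fst q) + snd q *\<^sub>R (h - z0), snd q))) (at (\<Psi>i (v, e)))"
      by (simp add: \<Psi>i_def h_def reg_deriv_apply add.assoc)
    show "bounded_linear (\<lambda>q. (?B (fst q - snd q *\<^sub>R (h - z0)), snd q))"
      by (intro bounded_linear_Pair bounded_linear_sub bounded_linear_fst
          bounded_linear_scaleR_const bounded_linear_snd bounded_linear_compose[OF bounded_linear_inv_reg_deriv[OF e]])
    show "(\<lambda>q. (?B (fst q - snd q *\<^sub>R (h - z0)), snd q)) \<circ>
        (\<lambda>q. (reg_deriv e h (fst q) + snd q *\<^sub>R (h - z0), snd q)) = id"
      using e by (auto simp: fun_eq_iff inv_reg_deriv)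
    show "continuous (at (v, e)) \<Psi>i"
      unfolding \<Psi>i_def by (intro continuous_intros isCont_resolvent e)
    show "\<Psi> (\<Psi>i p) = p" if "p \<in> UNIV \<times> {0<..}" for p
      using that by (auto simp: \<Psi>_def \<Psi>i_def reg_resolvent)
  qed (use e in \<open>auto intro: open_Times\<close>)
  from has_derivative_fst[OF this] show ?thesis
    by (simp add: \<Psi>i_def)
qed

text \<open>The chain rule in the form used twice: a constant \<open>v = 0\<close> yields the path
  of regularized solutions, and a solution \<open>v\<close> of the residual equation yields the
  Newton flow.\<close>

lemma resolvent_has_vector_derivative:
  fixes v
  assumes v: "(v has_vector_derivative v') (at t within S)"
    and \<epsilon>: "(\<epsilon> has_real_derivative \<epsilon>') (at t within S)" "0 < \<epsilon> t"
  defines "h \<equiv> resolvent (\<epsilon> t) (v t)"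
  shows "((\<lambda>s. resolvent (\<epsilon> s) (v s)) has_vector_derivative
      inv (reg_deriv (\<epsilon> t) h) (v' - \<epsilon>' *\<^sub>R (h - z0))) (at t within S)"
proof -
  interpret B: bounded_linear "inv (reg_deriv (\<epsilon> t) h)"
    by (rule bounded_linear_inv_reg_deriv[OF \<epsilon>(2)])
  have pair: "((\<lambda>s. (v s, \<epsilon> s)) has_derivative (\<lambda>q. (q *\<^sub>R v', q * \<epsilon>'))) (at t within S)"
    using v \<epsilon>(1) unfolding has_vector_derivative_def has_field_derivative_def
    by (auto intro!: derivative_eq_intros simp: mult.commute)
  have *: "inv (reg_deriv (\<epsilon> t) h) (q *\<^sub>R v' - (q * \<epsilon>') *\<^sub>R (h - z0))
      = q *\<^sub>R inv (reg_deriv (\<epsilon> t) h) (v' - \<epsilon>' *\<^sub>R (h - z0))" for q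
    by (subst B.scaleR[symmetric]) (simp add: scaleR_diff_right)
  have "((\<lambda>s. resolvent (\<epsilon> s) (v s)) has_derivative
      (\<lambda>q. inv (reg_deriv (\<epsilon> t) h) (q *\<^sub>R v' - (q * \<epsilon>') *\<^sub>R (h - z0)))) (at t within S)"
    using has_derivative_compose[of "\<lambda>s. (v s, \<epsilon> s)" _ t S "\<lambda>p. resolvent (snd p) (fst p)",
        OF pair resolvent_has_derivative[OF \<epsilon>(2), of "v t"]]
    by (simp add: h_def)
  then show ?thesis
    unfolding has_vector_derivative_def * .
qed

end

section \<open>A scalar barrier argument\<close>

text \<open>At the first time \<open>T\<close> where the function is nonnegative it must vanish, by
  continuity. Its derivative there is negative, so it was positive just before \<open>T\<close>,
  against the choice of \<open>T\<close>.\<close>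

lemma stays_negative:
  fixes \<phi> :: "real \<Rightarrow> real"
  assumes init: "\<phi> 0 < 0"
    and deriv: "\<And>t. 0 \<le> t \<Longrightarrow> (\<phi> has_real_derivative \<phi>' t) (at t within {0..})"
    and barrier: "\<And>t. 0 \<le> t \<Longrightarrow> \<phi> t = 0 \<Longrightarrow> \<phi>' t < 0"
    and t: "0 \<le> t"
  shows "\<phi> t < 0"
proof (rule ccontr)
  assume neg: "\<not> \<phi> t < 0"
  have cont: "continuous_on {0..} \<phi>"
    using deriv by (intro DERIV_continuous_on) auto
  define S where "S = {s \<in> {0..t}. 0 \<le> \<phi> s}"
  have "continuous_on {0..t} \<phi>"
    using cont by (rule continuous_on_subset) auto
  then have "closed S"
    unfolding S_def by (intro continuous_on_closed_Collect_le) auto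
  moreover have S: "t \<in> S" "bdd_below S"
    using neg t by (auto simp: S_def intro: bdd_belowI[of _ 0])
  ultimately have "Inf S \<in> S"
    by (intro closed_contains_Inf) auto
  define T where "T = Inf S"
  have T: "0 \<le> T" "T \<le> t" "0 \<le> \<phi> T"
    using \<open>Inf S \<in> S\<close> by (auto simp: S_def T_def)
  have before: "\<phi> s < 0" if "0 \<le> s" "s < T" for s
  proof (rule ccontr)
    assume "\<not> \<phi> s < 0"
    then have "s \<in> S" using that T by (auto simp: S_def)
    then show False using cInf_lower[of s S] S that by (simp add: T_def)
  qed
  have "T \<noteq> 0" using T init by auto
  have "\<phi> T = 0"
  proof (rule ccontr)
    assume "\<phi> T \<noteq> 0"
    moreover have "continuous_on {0..T} \<phi>"
      using cont by (rule continuous_on_subset) auto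
    ultimately obtain s where s: "0 \<le> s" "s \<le> T" "\<phi> s = 0"
      using IVT'[of \<phi> 0 0 T] init T by auto
    with before[of s] \<open>\<phi> T \<noteq> 0\<close> show False by (cases "s = T") auto
  qed
  then obtain d where d: "0 < d" "\<And>h. 0 < h \<Longrightarrow> T - h \<in> {0..} \<Longrightarrow> h < d \<Longrightarrow> \<phi> T < \<phi> (T - h)"
    using has_real_derivative_neg_dec_left[OF deriv[OF T(1)] barrier[OF T(1)]] by auto
  \<comment> \<open>The cap by \<open>T\<close> keeps \<open>T - h\<close> in the half-line, where
    the one-sided derivative gives information.\<close>
  define h where "h = min (d / 2) T"
  have h: "0 < h" "h < d" "0 \<le> T - h" "T - h < T"
    using d T \<open>T \<noteq> 0\<close> by (auto simp: h_def)
  then have "\<phi> T < \<phi> (T - h)" "\<phi> (T - h) < 0"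
    using d before by auto
  then show False
    using \<open>\<phi> T = 0\<close> by simp
qed

lemma has_real_derivative_inner_self:
  assumes "(w has_vector_derivative w') (at t within S)"
  shows "((\<lambda>s. inner (w s) (w s)) has_real_derivative 2 * inner (w t) w') (at t within S)"
  using has_derivative_inner[OF assms[unfolded has_vector_derivative_def] assms[unfolded has_vector_derivative_def]]
  unfolding has_field_derivative_def by (rule has_derivative_eq_rhs) (auto simp: inner_commute algebra_simps)

section \<open>Convergence of the regularized solutions\<close>

context monotone_operator
begin

lemma F_resolvent: "0 < e \<Longrightarrow> F (resolvent e 0) = - e *\<^sub>R (resolvent e 0 - z0)"
  using reg_resolvent[of e 0] by (simp add: reg_def eq_neg_iff_add_eq_0)

text \<open>Testing monotonicity between the regularized solution \<open>x\<close> and the root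
  \<open>y\<close> gives \<open>inner (x - z0) (x - y) \<le> 0\<close>; the Cauchy-Schwarz
  inequality does the rest.\<close>

lemma norm_resolvent_diff:
  assumes "0 < e" "F y = 0"
  shows "norm (resolvent e 0 - z0) \<le> norm (z0 - y)"
proof -
  define x where "x = resolvent e 0"
  have "e * inner (x - z0) (x - y) \<le> 0"
    using F_monotone[of x y] F_resolvent[OF assms(1)] assms(2) by (simp add: x_def)
  then have "inner (x - z0) ((x - z0) + (z0 - y)) \<le> 0"
    using assms(1) by (simp add: mult_le_0_iff)
  then have "norm (x - z0) * norm (x - z0) \<le> inner (x - z0) (- (z0 - y))"
    by (simp only: inner_add_right inner_minus_right dot_square_norm power2_eq_square)
  also have "\<dots> \<le> norm (x - z0) * norm (z0 - y)"
    using norm_cauchy_schwarz[of "x - z0" "- (z0 - y)"] by (simp only: norm_minus_cancel)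
  finally show ?thesis
    unfolding x_def[symmetric] by (cases "x = z0") (auto simp: mult_le_cancel_left)
qed

text \<open>Monotonicity applied to the two regularized equations yields
  \<open>0 \<le> inner b (a - b)\<close>. In the expansion of the square of \<open>norm a\<close>
  around \<open>b\<close> the cross term may therefore be dropped.\<close>

lemma resolvent_diff_square:
  assumes "0 < e" "e \<le> e'"
  shows "(norm (resolvent e 0 - resolvent e' 0))\<^sup>2
      \<le> (norm (resolvent e 0 - z0))\<^sup>2 - (norm (resolvent e' 0 - z0))\<^sup>2"
proof (cases "e = e'")
  case False
  define a b where "a = resolvent e 0 - z0" and "b = resolvent e' 0 - z0"
  have "0 \<le> inner (F (resolvent e 0) - F (resolvent e' 0)) (a - b)"
    using F_monotone[of "resolvent e 0" "resolvent e' 0"] by (simp add: a_def b_def)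
  also have "F (resolvent e 0) - F (resolvent e' 0) = (e' - e) *\<^sub>R b - e *\<^sub>R (a - b)"
    using assms by (simp add: F_resolvent a_def b_def algebra_simps)
  finally have "e * inner (a - b) (a - b) \<le> (e' - e) * inner b (a - b)"
    by (simp add: inner_diff_left[of "(e' - e) *\<^sub>R b"])
  moreover have "0 \<le> e * inner (a - b) (a - b)"
    using assms by simp
  ultimately have "0 \<le> (e' - e) * inner b (a - b)"
    by linarith
  then have "0 \<le> inner b (a - b)"
    using assms False by (simp add: zero_le_mult_iff)
  moreover have "(norm a)\<^sup>2 = (norm b)\<^sup>2 + 2 * inner b (a - b) + (norm (a - b))\<^sup>2"
    unfolding power2_norm_eq_inner by (simp add: inner_diff_left inner_diff_right inner_commute)
  moreover have "resolvent e 0 - resolvent e' 0 = a - b"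
    by (simp add: a_def b_def)
  ultimately show ?thesis
    unfolding a_def[symmetric] b_def[symmetric] by simp
qed simp

text \<open>The norms of \<open>resolvent e 0 - z0\<close> increase as \<open>e\<close> decreases and are bounded, so
  \<open>resolvent_diff_square\<close> makes the regularized solutions a strong Cauchy family; no weak
  compactness is needed.\<close>

lemma resolvent_tendsto_root:
  assumes root: "F y = 0" and unique: "\<And>u. F u = 0 \<Longrightarrow> u = y"
  shows "((\<lambda>e. resolvent e 0) \<longlongrightarrow> y) (at_right 0)"
proof (rule tendsto_at_right_sequentially[of 0 1])
  fix S :: "nat \<Rightarrow> real"
  \<comment> \<open>Decreasing parameter sequences suffice for a limit from the right, and along
    them the distances to \<open>z0\<close> increase.\<close>
  assume S: "\<And>n. 0 < S n" "decseq S" "S \<longlonglongrightarrow> 0"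
  let ?x = "\<lambda>n. resolvent (S n) 0"
  let ?n = "\<lambda>n. (norm (?x n - z0))\<^sup>2"
  have diff: "(norm (?x n - ?x m))\<^sup>2 \<le> ?n n - ?n m" if "m \<le> n" for m n
    using S(1) decseqD[OF S(2) that] by (intro resolvent_diff_square)
  have "?n n \<le> ?n (Suc n)" for n
    using order_trans[OF zero_le_power2 diff[of n "Suc n"]] by simp
  then have "incseq ?n"
    by (rule incseq_SucI)
  moreover have "?n n \<le> (norm (z0 - y))\<^sup>2" for n
    using norm_resolvent_diff[OF S(1) root] by (intro power_mono) auto
  ultimately obtain L where "?n \<longlonglongrightarrow> L"
    using incseq_convergent[of ?n "(norm (z0 - y))\<^sup>2"] by blast
  then have "convergent ?n"
    by (rule convergentI)
  then have Cauchy_n: "Cauchy ?n"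
    by (rule convergent_Cauchy)
  have "Cauchy ?x"
  proof (rule CauchyI)
    fix d :: real assume d: "0 < d"
    then obtain N where N: "\<And>m n. N \<le> m \<Longrightarrow> N \<le> n \<Longrightarrow> norm (?n m - ?n n) < d\<^sup>2"
      using CauchyD[OF Cauchy_n, of "d\<^sup>2"] by auto
    have "norm (?x n - ?x m) < d" if "N \<le> m" "m \<le> n" for m n
    proof (rule power2_less_imp_less)
      show "(norm (?x n - ?x m))\<^sup>2 < d\<^sup>2"
        using diff[OF that(2)] N[of n m] that by auto
    qed (use d in simp)
    then show "\<exists>N. \<forall>m\<ge>N. \<forall>n\<ge>N. norm (?x m - ?x n) < d"
      by (metis linear norm_minus_commute)
  qed
  then obtain \<xi> where \<xi>: "?x \<longlonglongrightarrow> \<xi>"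
    using Cauchy_convergent convergent_def by blast
  \<comment> \<open>The limit is identified by strong continuity of \<open>F\<close>: the
    regularized equation makes \<open>F (?x n)\<close> a vanishing multiple of a convergent
    sequence.\<close>
  have "(\<lambda>n. F (?x n)) \<longlonglongrightarrow> F \<xi>"
    using has_derivative_continuous[OF F_deriv] \<xi> by (rule isCont_tendsto_compose)
  moreover have "(\<lambda>n. F (?x n)) \<longlonglongrightarrow> - 0 *\<^sub>R (\<xi> - z0)"
    unfolding F_resolvent[OF S(1)] by (intro tendsto_intros S \<xi>)
  ultimately have "F \<xi> = 0"
    using LIMSEQ_unique by force
  then show "?x \<longlonglongrightarrow> y"
    using \<xi> unique by blast
qed simp

end

section \<open>Existence and uniqueness for the Newton flow\<close>

locale newton_flow = monotone_operator +
  fixes y :: 'a and C :: real and \<epsilon> \<epsilon>' :: "real \<Rightarrow> real"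
  assumes root: "F y = 0"
    and N2_pos: "N2 > 0"
    and eps_pos: "\<And>t. t \<ge> 0 \<Longrightarrow> \<epsilon> t > 0"
    and eps_deriv: "\<And>t. t \<ge> 0 \<Longrightarrow> (\<epsilon> has_real_derivative \<epsilon>' t) (at t within {0..})"
    and eps_deriv_cont: "continuous_on {0..} \<epsilon>'"
    and eps_antimono: "antimono_on {0..} \<epsilon>"
    and C_upper: "\<And>t. t \<ge> 0 \<Longrightarrow> \<epsilon> 0 * \<bar>\<epsilon>' t\<bar> / (\<epsilon> t)\<^sup>2 \<le> C"
    and C_less: "C < 1"
    and eps0_large: "\<epsilon> 0 > N2 * norm (z0 - y) / (1 - C) * max 1 (2 * C / (1 - C))"
begin

definition reg_path :: "real \<Rightarrow> 'a" where
  "reg_path t = resolvent (\<epsilon> t) 0"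

lemma C_nonneg: "0 \<le> C"
  using C_upper[of 0] eps_pos[of 0] by (auto intro: order_trans[rotated])

lemma eps_le: "0 \<le> t \<Longrightarrow> \<epsilon> t \<le> \<epsilon> 0"
  using eps_antimono by (auto simp: monotone_on_def)

text \<open>The quadratic form of the bound keeps the factor
  \<open>\<epsilon> t / \<epsilon> 0\<close>, which the estimate of the path's drift needs; the
  linear form \<open>eps'_le\<close> controls the decrease of the barrier.\<close>

lemma eps'_le_square: "0 \<le> t \<Longrightarrow> \<bar>\<epsilon>' t\<bar> \<le> C * (\<epsilon> t / \<epsilon> 0) * \<epsilon> t"
  using C_upper[of t] eps_pos[of t] eps_pos[of 0] by (simp add: field_simps power2_eq_square)

lemma eps'_le:
  assumes "0 \<le> t"
  shows "\<bar>\<epsilon>' t\<bar> \<le> C * \<epsilon> t"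
proof -
  have "C * (\<epsilon> t / \<epsilon> 0) * \<epsilon> t \<le> C * 1 * \<epsilon> t"
    using assms C_nonneg eps_pos[of t] eps_pos[of 0] eps_le[of t]
    by (intro mult_right_mono mult_left_mono) auto
  then show ?thesis
    using eps'_le_square[OF assms] by simp
qed

lemma eps'_le_eps:
  assumes "0 \<le> t"
  shows "\<bar>\<epsilon>' t\<bar> \<le> \<epsilon> t"
proof -
  have "C * \<epsilon> t \<le> 1 * \<epsilon> t"
    using C_less eps_pos[OF assms] by (intro mult_right_mono) auto
  then show ?thesis
    using eps'_le[OF assms] by simp
qed

text \<open>The Newton direction solves the linearized equation exactly, so the motion of
  \<open>w\<close> contributes minus the residual. What remains is the explicit time dependence
  through \<open>\<epsilon>\<close>.\<close>

lemma residual_has_vector_derivative: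
  assumes w: "(w has_vector_derivative newton_field F F' \<epsilon> z0 (w t) t) (at t within {0..})" and t: "0 \<le> t"
  shows "((\<lambda>s. reg (\<epsilon> s) (w s)) has_vector_derivative
      - reg (\<epsilon> t) (w t) + \<epsilon>' t *\<^sub>R (w t - z0)) (at t within {0..})"
proof -
  let ?w' = "newton_field F F' \<epsilon> z0 (w t) t"
  have "((\<lambda>s. F (w s)) has_vector_derivative F' (w t) ?w') (at t within {0..})"
    using has_derivative_compose[OF w[unfolded has_vector_derivative_def] F_deriv]
    by (simp add: has_vector_derivative_def blinfun.scaleR_right)
  then have "((\<lambda>s. reg (\<epsilon> s) (w s)) has_vector_derivative
      F' (w t) ?w' + (\<epsilon> t *\<^sub>R ?w' + \<epsilon>' t *\<^sub>R (w t - z0))) (at t within {0..})"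
    unfolding reg_def using w eps_deriv[OF t]
    by (auto intro!: has_vector_derivative_add has_vector_derivative_scaleR derivative_eq_intros)
  moreover have "F' (w t) ?w' + \<epsilon> t *\<^sub>R ?w' = - reg (\<epsilon> t) (w t)"
    unfolding reg_deriv_apply[symmetric] newton_field_eq linear_neg[OF linear_reg_deriv]
    using reg_deriv_inv[OF eps_pos[OF t]] by simp
  ultimately show ?thesis
    by (simp add: add.assoc[symmetric])
qed

text \<open>The residual equation is solved first and \<open>z\<close> is recovered through the
  resolvent. In the derivative of the resolvent path the two terms with \<open>\<epsilon>'\<close>
  cancel, leaving the Newton field.\<close>

lemma newton_solution_exists: "\<exists>z. solves_cauchy (newton_field F F' \<epsilon> z0) z0 z"
proof -
  let ?g = "\<lambda>t u. - u + \<epsilon>' t *\<^sub>R (resolvent (\<epsilon> t) u - z0)"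
  have "\<exists>v. v 0 = reg (\<epsilon> 0) z0 \<and> (\<forall>t\<ge>0. (v has_vector_derivative ?g t (v t)) (at t within {0..}))"
  \<comment> \<open>The constant 2 is 1 from \<open>- u\<close> plus 1 from
    \<open>\<bar>\<epsilon>' t\<bar> / \<epsilon> t \<le> 1\<close>. At \<open>u = 0\<close> the
    resolvent is the regularized solution, whose distance to \<open>z0\<close> is at most
    \<open>norm (z0 - y)\<close>.\<close>
  proof (rule picard_global[where L = 2 and M = "\<epsilon> 0 * norm (z0 - y)"])
    have "continuous_on {0..} \<epsilon>"
      using eps_deriv by (intro DERIV_continuous_on) auto
    then have "continuous_on ({0..} \<times> UNIV) (\<lambda>q::real \<times> 'a. (snd q, \<epsilon> (fst q)))"
      by (intro continuous_intros continuous_on_compose2[of "{0..}" \<epsilon> _ fst]) auto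
    moreover have "continuous_on (UNIV \<times> {0<..}) (\<lambda>p. resolvent (snd p) (fst p))"
      using isCont_resolvent by (intro continuous_at_imp_continuous_on) auto
    ultimately have "continuous_on ({0..} \<times> UNIV) (\<lambda>q. resolvent (\<epsilon> (fst q)) (snd q))"
      using continuous_on_compose2[of "UNIV \<times> {0<..}" "\<lambda>p. resolvent (snd p) (fst p)"
          "{0..} \<times> UNIV" "\<lambda>q. (snd q, \<epsilon> (fst q))"] eps_pos by force
    moreover have "continuous_on ({0..} \<times> UNIV) (\<lambda>q::real \<times> 'a. \<epsilon>' (fst q))"
      by (intro continuous_on_compose2[OF eps_deriv_cont] continuous_intros) auto
    ultimately show "continuous_on ({0..} \<times> UNIV) (\<lambda>(t, u). ?g t u)"
      unfolding case_prod_unfold by (intro continuous_intros)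
    show "norm (?g t u - ?g t v) \<le> 2 * norm (u - v)" if t: "0 \<le> t" for t u v
    proof -
      have "?g t u - ?g t v = \<epsilon>' t *\<^sub>R (resolvent (\<epsilon> t) u - resolvent (\<epsilon> t) v) - (u - v)"
        by (simp add: algebra_simps)
      then have "norm (?g t u - ?g t v) \<le> \<bar>\<epsilon>' t\<bar> * norm (resolvent (\<epsilon> t) u - resolvent (\<epsilon> t) v) + norm (u - v)"
        by (metis norm_triangle_ineq4 norm_scaleR)
      also have "\<dots> \<le> \<epsilon> t * (norm (u - v) / \<epsilon> t) + norm (u - v)"
        using eps_pos[OF t] eps'_le_eps[OF t] resolvent_lipschitz by (intro add_mono mult_mono) auto
      finally show ?thesis
        using eps_pos[OF t] by simp
    qed
    show "norm (?g t 0) \<le> \<epsilon> 0 * norm (z0 - y)" if t: "0 \<le> t" for t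
      using eps_pos[OF t] eps'_le_eps[OF t] eps_le[OF t] norm_resolvent_diff[OF _ root]
      by (auto intro!: mult_mono)
  qed simp
  then obtain v where v: "v 0 = reg (\<epsilon> 0) z0"
    "\<And>t. 0 \<le> t \<Longrightarrow> (v has_vector_derivative ?g t (v t)) (at t within {0..})" by blast
  have "((\<lambda>s. resolvent (\<epsilon> s) (v s)) has_vector_derivative
      newton_field F F' \<epsilon> z0 (resolvent (\<epsilon> t) (v t)) t) (at t within {0..})" if t: "0 \<le> t" for t
    using resolvent_has_vector_derivative[OF v(2)[OF t] eps_deriv[OF t] eps_pos[OF t]] eps_pos[OF t]
      linear_neg[OF bounded_linear.linear[OF bounded_linear_inv_reg_deriv]]
    by (simp add: newton_field_eq reg_resolvent)
  then show ?thesis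
    unfolding solves_cauchy_def using v(1) eps_pos
    by (intro exI[of _ "\<lambda>t. resolvent (\<epsilon> t) (v t)"]) (simp add: resolvent_reg)
qed

text \<open>The difference \<open>d\<close> of the residuals of two solutions has nonincreasing
  norm: by \<open>reg_expanding\<close> the drift term is dominated by the damping term
  \<open>- d\<close>. Equal residuals then give equal points, since \<open>reg\<close> is
  injective.\<close>

lemma newton_solution_unique:
  assumes w: "solves_cauchy (newton_field F F' \<epsilon> z0) z0 w"
    and z: "solves_cauchy (newton_field F F' \<epsilon> z0) z0 z"
    and t: "0 \<le> t"
  shows "w t = z t"
proof -
  define d where "d s = reg (\<epsilon> s) (w s) - reg (\<epsilon> s) (z s)" for s
  define d' where "d' s = - d s + \<epsilon>' s *\<^sub>R (w s - z s)" for s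
  have "(d has_vector_derivative d' s) (at s within {0..})" if "0 \<le> s" for s
  proof -
    have "(w has_vector_derivative newton_field F F' \<epsilon> z0 (w s) s) (at s within {0..})"
      "(z has_vector_derivative newton_field F F' \<epsilon> z0 (z s) s) (at s within {0..})"
      using w z that by (auto simp: solves_cauchy_def)
    from has_vector_derivative_diff[OF this[THEN residual_has_vector_derivative[OF _ that]]]
    show ?thesis
      unfolding d_def d'_def by (simp add: algebra_simps)
  qed
  then have deriv: "((\<lambda>s. inner (d s) (d s)) has_real_derivative 2 * inner (d s) (d' s)) (at s within {0..})"
    if "0 \<le> s" for s
    using has_real_derivative_inner_self that by blast
  have nonpos: "inner (d s) (d' s) \<le> 0" if s: "0 \<le> s" for s
  proof -
    have "\<bar>\<epsilon>' s\<bar> * norm (w s - z s) \<le> \<epsilon> s * norm (w s - z s)"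
      using eps'_le_eps[OF s] by (intro mult_right_mono) auto
    also have "\<dots> \<le> norm (d s)"
      unfolding d_def by (rule reg_expanding)
    finally have "norm (d s) * norm (\<epsilon>' s *\<^sub>R (w s - z s)) \<le> norm (d s) * norm (d s)"
      by (intro mult_left_mono) auto
    then have "inner (d s) (\<epsilon>' s *\<^sub>R (w s - z s)) \<le> inner (d s) (d s)"
      using norm_cauchy_schwarz[of "d s" "\<epsilon>' s *\<^sub>R (w s - z s)"]
      by (simp add: dot_square_norm power2_eq_square)
    then show ?thesis
      by (simp add: d'_def inner_diff_right)
  qed
  have "inner (d t) (d t) \<le> inner (d 0) (d 0)"
  \<comment> \<open>Two-sided derivatives are available only at interior times; continuity covers
    the endpoint 0.\<close>
  proof (rule DERIV_nonpos_imp_decreasing_open[OF t, of "\<lambda>s. inner (d s) (d s)"])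
    fix s assume "0 < s" "s < t"
    then have "at s within {0..} = at s" by (intro at_within_interior) auto
    then show "\<exists>y. DERIV (\<lambda>s. inner (d s) (d s)) s :> y \<and> y \<le> 0"
      using deriv[of s] nonpos[of s] \<open>0 < s\<close> by (intro exI[of _ "2 * inner (d s) (d' s)"]) simp
  next
    have "continuous_on {0..} (\<lambda>s. inner (d s) (d s))"
      using deriv by (intro DERIV_continuous_on) auto
    then show "continuous_on {0..t} (\<lambda>s. inner (d s) (d s))"
      by (rule continuous_on_subset) auto
  qed
  also have "d 0 = 0"
    using w z by (simp add: d_def solves_cauchy_def)
  finally have "d t = 0"
    by (metis inner_gt_zero_iff inner_zero_left not_less)
  then have "reg (\<epsilon> t) (w t) = reg (\<epsilon> t) (z t)"
    by (simp add: d_def)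
  then show ?thesis
    using resolvent_reg[OF eps_pos[OF t]] by metis
qed

section \<open>The error barrier around the regularized path\<close>

text \<open>The norm of \<open>w = z - x\<close> satisfies
  \<open>|w|' \<le> - |w| + N2 |w|^2 / (2 \<epsilon>) + |\<epsilon>'| |z0 - y| / \<epsilon>\<close>, and the lower bound on \<open>\<epsilon> 0\<close> is exactly
  what keeps it below the barrier \<open>(1 - C) / N2 * \<epsilon>\<close>.\<close>

lemma newton_error_bound:
  assumes z: "solves_cauchy (newton_field F F' \<epsilon> z0) z0 z" and t: "0 \<le> t"
  shows "norm (z t - reg_path t) < (1 - C) / N2 * \<epsilon> t"
proof -
  define D where "D = norm (z0 - y)"
  define k where "k = (1 - C) / N2"
  define w where "w t = z t - reg_path t" for t
  define w' where "w' t = newton_field F F' \<epsilon> z0 (z t) t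
      - inv (reg_deriv (\<epsilon> t) (reg_path t)) (0 - \<epsilon>' t *\<^sub>R (reg_path t - z0))" for t
  \<comment> \<open>Squares are compared because the norm is not differentiable at 0 and
    \<open>w\<close> may vanish.\<close>
  define \<phi> where "\<phi> t = inner (w t) (w t) - (k * \<epsilon> t)\<^sup>2" for t
  have k: "0 < k" "N2 * k = 1 - C"
    using C_less N2_pos by (auto simp: k_def)
  have D: "0 \<le> D" by (simp add: D_def)
  \<comment> \<open>Each arm of the maximum in the lower bound on \<open>\<epsilon> 0\<close> gives
    one inequality: \<open>D1\<close> places the start below the barrier, and \<open>D2\<close>
    makes the drift small at a contact.\<close>
  have D1: "D < k * \<epsilon> 0" and D2: "C * D / \<epsilon> 0 < (1 - C) * k / 2"
  proof -
    have *: "0 \<le> N2 * D / (1 - C)" using N2_pos D C_less by simp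
    have "N2 * D / (1 - C) * 1 \<le> N2 * D / (1 - C) * max 1 (2 * C / (1 - C))"
      using * by (intro mult_left_mono) auto
    then have "N2 * D / (1 - C) < \<epsilon> 0"
      using eps0_large by (simp add: D_def)
    then show "D < k * \<epsilon> 0"
      using N2_pos C_less by (simp add: k_def field_simps)
    have "N2 * D / (1 - C) * (2 * C / (1 - C)) \<le> N2 * D / (1 - C) * max 1 (2 * C / (1 - C))"
      using * by (intro mult_left_mono) auto
    then have "N2 * D / (1 - C) * (2 * C / (1 - C)) < \<epsilon> 0"
      using eps0_large by (simp add: D_def)
    moreover define q where "q = 1 - C"
    ultimately have "N2 * D / q * (2 * C / q) < \<epsilon> 0" and q: "0 < q"
      using C_less by simp_all
    then have "2 * C * N2 * D < \<epsilon> 0 * q * q"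
      by (simp add: field_simps)
    then show "C * D / \<epsilon> 0 < (1 - C) * k / 2"
      using N2_pos eps_pos[of 0] unfolding k_def q_def[symmetric] by (simp add: field_simps)
  qed
  have w_deriv: "(w has_vector_derivative w' t) (at t within {0..})" if "0 \<le> t" for t
  proof -
    have "(reg_path has_vector_derivative
        inv (reg_deriv (\<epsilon> t) (reg_path t)) (0 - \<epsilon>' t *\<^sub>R (reg_path t - z0))) (at t within {0..})"
      using resolvent_has_vector_derivative[OF has_vector_derivative_const eps_deriv[OF that] eps_pos[OF that], of 0]
      by (simp add: reg_path_def[abs_def])
    moreover have "(z has_vector_derivative newton_field F F' \<epsilon> z0 (z t) t) (at t within {0..})"
      using z that by (simp add: solves_cauchy_def)
    ultimately show ?thesis
      unfolding w_def w'_def by (intro has_vector_derivative_diff)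
  qed
  have w'_eq: "inner (w t) (w' t) \<le> - (norm (w t))\<^sup>2
      + norm (w t) * (N2 / 2 * (norm (w t))\<^sup>2 / \<epsilon> t + \<bar>\<epsilon>' t\<bar> * D / \<epsilon> t)" if t: "0 \<le> t" for t
  proof -
    note pos = eps_pos[OF t]
    let ?B = "inv (reg_deriv (\<epsilon> t) (z t))" and ?Bx = "inv (reg_deriv (\<epsilon> t) (reg_path t))"
    \<comment> \<open>The remainder of the expansion of \<open>F\<close> at \<open>z t\<close>,
      evaluated at \<open>reg_path t\<close>. Since \<open>reg_path t\<close> solves the regularized
      equation, the Newton inverse turns the linear part into exactly \<open>- w t\<close> and
      leaves \<open>r\<close> as the error.\<close>
    define r where "r = F (reg_path t) - F (z t) - F' (z t) (reg_path t - z t)"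
    interpret B: bounded_linear ?B by (rule bounded_linear_inv_reg_deriv[OF pos])
    have "reg (\<epsilon> t) (reg_path t) = 0"
      using reg_resolvent[OF pos] by (simp add: reg_path_def)
    then have "reg (\<epsilon> t) (z t) = reg (\<epsilon> t) (z t) - reg (\<epsilon> t) (reg_path t)"
      by simp
    also have "\<dots> = reg_deriv (\<epsilon> t) (z t) (w t) - r"
      by (simp add: reg_def reg_deriv_apply w_def r_def blinfun.diff_right algebra_simps)
    finally have "newton_field F F' \<epsilon> z0 (z t) t = - w t + ?B r"
      by (simp add: newton_field_eq B.diff inv_reg_deriv[OF pos])
    then have "w' t = - w t + (?B r - ?Bx (0 - \<epsilon>' t *\<^sub>R (reg_path t - z0)))"
      by (simp add: w'_def)
    then have "inner (w t) (w' t) = - (norm (w t))\<^sup>2 + inner (w t) (?B r - ?Bx (0 - \<epsilon>' t *\<^sub>R (reg_path t - z0)))"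
      by (simp only: inner_add_right inner_minus_right dot_square_norm)
    also have "\<dots> \<le> - (norm (w t))\<^sup>2 + norm (w t) * (norm (?B r) + norm (?Bx (0 - \<epsilon>' t *\<^sub>R (reg_path t - z0))))"
      by (intro add_left_mono order_trans[OF norm_cauchy_schwarz] mult_left_mono norm_triangle_ineq4) simp
    also have "norm (?B r) \<le> N2 / 2 * (norm (w t))\<^sup>2 / \<epsilon> t"
      using F_taylor[of "reg_path t" "z t"] pos
      by (intro order_trans[OF norm_inv_reg_deriv] divide_right_mono) (auto simp: r_def w_def norm_minus_commute)
    also have "norm (?Bx (0 - \<epsilon>' t *\<^sub>R (reg_path t - z0))) \<le> \<bar>\<epsilon>' t\<bar> * D / \<epsilon> t"
      using norm_resolvent_diff[OF pos root] pos
      by (intro order_trans[OF norm_inv_reg_deriv] divide_right_mono) (auto simp: reg_path_def D_def mult_left_mono)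
    finally show ?thesis
      by (simp add: mult_left_mono)
  qed
  have "\<phi> t < 0"
  proof (rule stays_negative[where \<phi>' = "\<lambda>t. 2 * inner (w t) (w' t) - 2 * (k * \<epsilon> t) * (k * \<epsilon>' t)", OF _ _ _ t])
    have "norm (w 0) \<le> D"
      using z norm_resolvent_diff[OF eps_pos[of 0] root]
      by (simp add: w_def reg_path_def solves_cauchy_def D_def norm_minus_commute)
    then have "(norm (w 0))\<^sup>2 < (k * \<epsilon> 0)\<^sup>2"
      using D1 by (intro power_strict_mono) auto
    then show "\<phi> 0 < 0"
      by (simp add: \<phi>_def dot_square_norm)
  next
    fix t :: real assume t: "0 \<le> t"
    have "((\<lambda>s. inner (w s) (w s)) has_real_derivative 2 * inner (w t) (w' t)) (at t within {0..})"
      by (rule has_real_derivative_inner_self[OF w_deriv[OF t]])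
    moreover have "((\<lambda>s. (k * \<epsilon> s)\<^sup>2) has_real_derivative 2 * (k * \<epsilon> t) * (k * \<epsilon>' t)) (at t within {0..})"
      using eps_deriv[OF t] by (auto intro!: derivative_eq_intros)
    ultimately show "(\<phi> has_real_derivative 2 * inner (w t) (w' t) - 2 * (k * \<epsilon> t) * (k * \<epsilon>' t)) (at t within {0..})"
      unfolding \<phi>_def by (rule DERIV_diff)
  next
    fix t :: real assume t: "0 \<le> t" and "\<phi> t = 0"
    note pos = eps_pos[OF t]
    define u where "u = k * \<epsilon> t"
    have u: "0 < u" using k pos by (simp add: u_def)
    have "(norm (w t))\<^sup>2 = u\<^sup>2"
      using \<open>\<phi> t = 0\<close> by (simp add: \<phi>_def dot_square_norm u_def)
    then have norm_w: "norm (w t) = u"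
      using u by (simp add: power2_eq_iff_nonneg)
    have "\<bar>\<epsilon>' t\<bar> * D / \<epsilon> t \<le> (C * (\<epsilon> t / \<epsilon> 0) * \<epsilon> t) * D / \<epsilon> t"
      using eps'_le_square[OF t] D pos by (intro divide_right_mono mult_right_mono) auto
    also have "\<dots> = C * D / \<epsilon> 0 * \<epsilon> t"
      using pos by simp
    also have "\<dots> < (1 - C) * k / 2 * \<epsilon> t"
      using D2 pos by (intro mult_strict_right_mono)
    finally have 1: "\<bar>\<epsilon>' t\<bar> * D / \<epsilon> t < (1 - C) * u / 2"
      by (simp add: u_def)
    have "N2 / 2 * u\<^sup>2 / \<epsilon> t = (N2 * k) * u / 2"
      using pos by (simp add: u_def power2_eq_square)
    then have 2: "N2 / 2 * u\<^sup>2 / \<epsilon> t = (1 - C) * u / 2"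
      by (simp add: k)
    have "k * \<bar>\<epsilon>' t\<bar> \<le> k * (C * \<epsilon> t)"
      using eps'_le[OF t] k by (intro mult_left_mono) auto
    moreover have "k * - \<epsilon>' t \<le> k * \<bar>\<epsilon>' t\<bar>"
      using k by (intro mult_left_mono) auto
    ultimately have 3: "- (k * \<epsilon>' t) \<le> C * u"
      by (simp add: u_def mult_ac)
    \<comment> \<open>At a contact the damping \<open>- u\<close> pays for three terms:
      \<open>(1 - C) * u / 2\<close> for the Taylor remainder, strictly less than the same amount
      for the drift of the path, and at most \<open>C * u\<close> for the fall of the barrier. The
      strictness comes from \<open>D2\<close>.\<close>
    have "2 * inner (w t) (w' t) - 2 * u * (k * \<epsilon>' t)
        \<le> 2 * (- u\<^sup>2 + u * (N2 / 2 * u\<^sup>2 / \<epsilon> t + \<bar>\<epsilon>' t\<bar> * D / \<epsilon> t)) + 2 * u * (- (k * \<epsilon>' t))"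
      using w'_eq[OF t] by (simp add: norm_w)
    also have "\<dots> = 2 * u * (- u + (N2 / 2 * u\<^sup>2 / \<epsilon> t + \<bar>\<epsilon>' t\<bar> * D / \<epsilon> t) - k * \<epsilon>' t)"
      by (simp add: algebra_simps power2_eq_square)
    also have "\<dots> < 2 * u * 0"
    proof (rule mult_strict_left_mono)
      have "- u + (N2 / 2 * u\<^sup>2 / \<epsilon> t + \<bar>\<epsilon>' t\<bar> * D / \<epsilon> t) - k * \<epsilon>' t
          < - u + ((1 - C) * u / 2 + (1 - C) * u / 2) + C * u"
        using 1 2 3 by linarith
      also have "\<dots> = 0" by (simp add: algebra_simps)
      finally show "- u + (N2 / 2 * u\<^sup>2 / \<epsilon> t + \<bar>\<epsilon>' t\<bar> * D / \<epsilon> t) - k * \<epsilon>' t < 0" .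
    qed (use u in simp)
    finally show "2 * inner (w t) (w' t) - 2 * (k * \<epsilon> t) * (k * \<epsilon>' t) < 0"
      by (simp add: u_def)
  qed
  then have "(norm (w t))\<^sup>2 < (k * \<epsilon> t)\<^sup>2"
    by (simp add: \<phi>_def dot_square_norm)
  then have "norm (w t) < k * \<epsilon> t"
    by (rule power2_less_imp_less) (use k eps_pos[OF t] in simp)
  then show ?thesis
    by (simp add: w_def k_def)
qed

end

section \<open>Convergence of the flow to the root\<close>

theorem theorem3p10:
  fixes F :: "'a::{real_inner, complete_space} \<Rightarrow> 'a"
    and F' :: "'a \<Rightarrow> 'a \<Rightarrow>\<^sub>L 'a"
    and F'' :: "'a \<Rightarrow> 'a \<Rightarrow>\<^sub>L ('a \<Rightarrow>\<^sub>L 'a)"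
    and z0 y :: 'a
    and N1 N2 C :: real
    and \<epsilon> \<epsilon>' :: "real \<Rightarrow> real"
    and \<Phi> :: "'a \<Rightarrow> real \<Rightarrow> 'a"
    and x :: "real \<Rightarrow> 'a"
  assumes y_root: "F y = 0"
    and y_unique: "\<And>u. F u = 0 \<Longrightarrow> u = y"
    and F_wcont: "w_continuous F"
    and F_deriv: "\<And>h. (F has_derivative blinfun_apply (F' h)) (at h)"
    and F_deriv2: "\<And>h. (F' has_derivative blinfun_apply (F'' h)) (at h)"
    and F'_nonneg: "\<And>h \<xi>. inner (F' h \<xi>) \<xi> \<ge> 0"
    and N1_pos: "N1 > 0" and N2_pos: "N2 > 0"
    and F'_bound: "\<And>h. norm (F' h) \<le> N1"
    and F''_bound: "\<And>h. norm (F'' h) \<le> N2"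
    and eps_pos: "\<And>t. t \<ge> 0 \<Longrightarrow> \<epsilon> t > 0"
    and eps_deriv: "\<And>t. t \<ge> 0 \<Longrightarrow> (\<epsilon> has_real_derivative \<epsilon>' t) (at t within {0..})"
    and eps_deriv_cont: "continuous_on {0..} \<epsilon>'"
    and eps_antimono: "antimono_on {0..} \<epsilon>"
    and eps_lim: "(\<epsilon> \<longlongrightarrow> 0) at_top"
    and C_attained: "\<exists>t\<ge>0. C = \<epsilon> 0 * \<bar>\<epsilon>' t\<bar> / (\<epsilon> t)\<^sup>2"
    and C_upper: "\<And>t. t \<ge> 0 \<Longrightarrow> \<epsilon> 0 * \<bar>\<epsilon>' t\<bar> / (\<epsilon> t)\<^sup>2 \<le> C"
    and C_less: "C < 1"
    and eps0_large: "\<epsilon> 0 > N2 * norm (z0 - y) / (1 - C) * max 1 (2 * C / (1 - C))"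
    and Phi_def: "\<And>h t. t \<ge> 0 \<Longrightarrow> \<Phi> h t = newton_field F F' \<epsilon> z0 h t"
    and x_def: "\<And>t. t \<ge> 0 \<Longrightarrow> x t = regularized_solution F z0 (\<epsilon> t)"
  shows "\<exists>z. solves_cauchy \<Phi> z0 z
           \<and> (\<forall>w. solves_cauchy \<Phi> z0 w \<longrightarrow> (\<forall>t\<ge>0. w t = z t))
           \<and> (\<forall>t\<ge>0. norm (z t - x t) \<le> (1 - C) / N2 * \<epsilon> t)
           \<and> ((\<lambda>t. norm (z t - y)) \<longlongrightarrow> 0) at_top"
proof -
  interpret newton_flow F F' F'' N1 N2 z0 y C \<epsilon> \<epsilon>'
    by unfold_locales (fact assms)+
  have Phi: "solves_cauchy \<Phi> z0 z \<longleftrightarrow> solves_cauchy (newton_field F F' \<epsilon> z0) z0 z" for z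
    by (simp add: solves_cauchy_def Phi_def)
  have x: "x t = reg_path t" if "0 \<le> t" for t
    using that by (simp add: x_def reg_path_def eps_pos regularized_solution_eq)
  obtain z where z: "solves_cauchy (newton_field F F' \<epsilon> z0) z0 z"
    using newton_solution_exists by blast
  have bound: "norm (z t - x t) \<le> (1 - C) / N2 * \<epsilon> t" if "0 \<le> t" for t
    using newton_error_bound[OF z that] x[OF that] by simp
  have nonneg: "\<forall>\<^sub>F t in at_top. (0::real) \<le> t"
    by (rule eventually_ge_at_top)
  \<comment> \<open>Positivity makes \<open>\<epsilon>\<close> approach 0 from the right, where the
    resolvent limit is known; the second conjunct only matches the shape of
    \<open>filterlim_at\<close>.\<close>
  have pos: "\<forall>\<^sub>F t in at_top. 0 < \<epsilon> t \<and> \<epsilon> t \<noteq> 0"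
    using nonneg by eventually_elim (use eps_pos in force)
  have "filterlim \<epsilon> (at_right 0) at_top"
    using eps_lim pos by (simp add: filterlim_at)
  moreover have "((\<lambda>e. resolvent e 0) \<longlongrightarrow> y) (at_right 0)"
    using y_root y_unique by (rule resolvent_tendsto_root)
  ultimately have "(reg_path \<longlongrightarrow> y) at_top"
    unfolding reg_path_def by (intro filterlim_compose[of "\<lambda>e. resolvent e 0" _ _ \<epsilon>])
  moreover have "((\<lambda>t. z t - reg_path t) \<longlongrightarrow> 0) at_top"
  proof (rule Lim_null_comparison)
    show "\<forall>\<^sub>F t in at_top. norm (z t - reg_path t) \<le> (1 - C) / N2 * \<epsilon> t"
      using nonneg by eventually_elim (use bound x in auto)
    show "((\<lambda>t. (1 - C) / N2 * \<epsilon> t) \<longlongrightarrow> 0) at_top"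
      by (rule tendsto_mult_right_zero[OF eps_lim])
  qed
  ultimately have "((\<lambda>t. norm ((z t - reg_path t) + (reg_path t - y))) \<longlongrightarrow> norm (0 + (y - y))) at_top"
    by (intro tendsto_intros)
  then have "((\<lambda>t. norm (z t - y)) \<longlongrightarrow> 0) at_top"
    by simp
  then show ?thesis
    using z bound newton_solution_unique by (intro exI[of _ z]) (auto simp: Phi)
qed

end
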